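(* Let $\mathbf{A}\in\mathcal{L}_{\mathrm{TV}}^{n,n}$ and $\mathbf{B}\in\mathcal{L}_{\mathrm{TV}}^{n,p}$, and consider the system $\mathbf{x} = \mathbf{S}_+\mathbf{A}\mathbf{x} + \mathbf{S}_+\mathbf{B}\mathbf{u} + \mathbf{S}_+\mathbf{w}$, $x_0=0$. Suppose that $\hat{\boldsymbol{\Phi}}_x,\hat{\boldsymbol{\Phi}}_u$ are strictly causal, linear, $\ell_\infty$-stable operators satisfying $$\begin{bmatrix} I-\mathbf{S}_+\mathbf{A} & -\mathbf{S}_+\mathbf{B}\end{bmatrix}\begin{bmatrix}\hat{\boldsymbol{\Phi}}_x\\ \hat{\boldsymbol{\Phi}}_u\end{bmatrix}=\mathbf{S}_+(I-\boldsymbol{\Delta}),$$ for $\boldsymbol{\Delta}$ a strictly causal linear operator from $\ell^n_{\infty,e}$ to $\ell^n_{\infty,e}$. Then the controller implementation $$\mathbf{u}=\hat{\boldsymbol{\Phi}}_u\mathbf{S}_-\hat{\mathbf{w}},\qquad \hat{\mathbf{w}}=\mathbf{x}-\hat{\mathbf{x}},\ \ \hat w_0=0,\qquad \hat{\mathbf{x}}=(\hat{\boldsymbol{\Phi}}_x\mathbf{S}_--I)\hat{\mathbf{w}}$$ is well posed and achieves the closed loop response $$\begin{bmatrix}\mathbf{x}\\ \mathbf{u}\end{bmatrix}=\begin{bmatrix}\hat{\boldsymbol{\Phi}}_x\\ \hat{\boldsymbol{\Phi}}_u\end{bmatrix}(I-\boldsymbol{\Delta})^{-1}\mathbf{w}.$$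 Further, this interconnection is $\ell_\infty$-stable if and only if $(I-\boldsymbol{\Delta})^{-1}$ is $\ell_\infty$-stable.
   Context: Signals: $\ell^q_{\infty,e}$ is the space of all $q$-tuples of real sequences, i.e. sequences $\mathbf{x}=(x_t)_{t=0}^\infty$ with $x_t\in\mathbb{R}^q$; $\ell^q_\infty$ is the subspace of bounded ones, with norm $\|\mathbf{x}\|_{\ell_\infty}=\max_i\sup_t|x^i_t|$. Operators: $\mathbf{S}_+$ is the right shift $\mathbf{S}_+(x_0,x_1,\dots)=(0,x_0,x_1,\dots)$ and $\mathbf{S}_-$ the left shift $\mathbf{S}_-(x_0,x_1,\dots)=(x_1,x_2,\dots)$. $\mathcal{L}_{\mathrm{TV}}^{p,q}$ is the space of bounded linear causal operators $\ell^q_\infty\to\ell^p_\infty$, with induced norm $\|\mathbf{R}\|_{\ell_\infty\to\ell_\infty}=\sup_{\|\mathbf{x}\|_{\ell_\infty}\le 1}\|\mathbf{R}\mathbf{x}\|_{\ell_\infty}$. Each such operator is represented by a block lower-triangular pulse response matrix and so also acts on the extended spaces. A linear causal operator is strictly causal if its output at time $t$ depends only on inputs at times strictly less than $t$. A linear map between extended spaces is $\ell_\infty$-stable if it is causal, takes bounded signals to bounded signals, and has finite induced norm, i.e. it defines an element of $\mathcal{L}_{\mathrm{TV}}$. Here $\hat{\boldsymbol{\Phi}}_x\in\mathcal{L}_{\mathrm{TV}}^{n,n}$ and $\hat{\boldsymbol{\Phi}}_u\in\mathcal{L}_{\mathrm{TV}}^{p,n}$. Interconnection: a perturbation $\boldsymbol{\delta}_y$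 is added to the measurement $\mathbf{x}$ entering the controller and $\boldsymbol{\delta}_u$ is added to the controller output, giving $$\mathbf{x}=\mathbf{S}_+\mathbf{A}\mathbf{x}+\mathbf{S}_+\mathbf{B}\mathbf{u}+\mathbf{S}_+\mathbf{w},\ x_0=0,\qquad \mathbf{u}=\hat{\boldsymbol{\Phi}}_u\mathbf{S}_-\hat{\mathbf{w}}+\boldsymbol{\delta}_u,\qquad \hat{\mathbf{w}}=\mathbf{x}+\boldsymbol{\delta}_y+(I-\hat{\boldsymbol{\Phi}}_x\mathbf{S}_-)\hat{\mathbf{w}},\ \hat w_0=0,$$ where $\hat w_0=0$ is an imposed initial condition, the last equation being understood at times $t\ge1$. It is well posed if these equations have a unique solution in the extended spaces for all inputs in the extended spaces, and $\ell_\infty$-stable if moreover the map $(\mathbf{w},\boldsymbol{\delta}_y,\boldsymbol{\delta}_u)\mapsto(\mathbf{x},\mathbf{u},\hat{\mathbf{w}})$ is $\ell_\infty$-stable. The closed loop response is the map $\mathbf{w}\mapsto(\mathbf{x},\mathbf{u})$ with $\boldsymbol{\delta}_y=0$ and $\boldsymbol{\delta}_u=0$. *)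

theory Defs
  imports "HOL-Analysis.Analysis" "HOL-Library.Function_Algebras"
begin

text \<open>Pointwise scalar multiplication. Together with the pointwise addition of
  \<^theory>\<open>HOL-Library.Function_Algebras\<close> it makes signals, and operators between signals, real vector spaces. Beware that \<open>\<circ>\<close> binds
  weaker than \<open>+\<close> and \<open>-\<close>.\<close>

instantiation "fun" :: (type, real_vector) real_vector
begin

definition scaleR_fun :: "real \<Rightarrow> ('a \<Rightarrow> 'b) \<Rightarrow> 'a \<Rightarrow> 'b" where
  "scaleR_fun c f = (\<lambda>x. c *\<^sub>R f x)"

instance
  by standard (auto simp: scaleR_fun_def fun_eq_iff scaleR_add_right scaleR_add_left)

end


section \<open>Signals\<close>

text \<open>\<open>'a signal\<close> is the extended space of all sequences. Tuples of signals such as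
  \<open>(w, \<delta>\<^sub>y, \<delta>\<^sub>u)\<close> are signals with values in a product space, which is again Euclidean.\<close>

type_synonym 'a signal = "nat \<Rightarrow> 'a"

definition linf :: "'a::euclidean_space signal set" where
  "linf = {x. bounded (range x)}"

text \<open>The basis elements pick out the scalar components: \<open>x t \<bullet> axis i 1 = x t $ i\<close> on
  \<^typ>\<open>real ^ 'n\<close>, and the basis of a product is the union of the two bases.
  See the two lemmas below. Only meaningful on \<^const>\<open>linf\<close>.\<close>

definition linf_norm :: "'a::euclidean_space signal \<Rightarrow> real" where
  "linf_norm x = (MAX b\<in>Basis. SUP t. \<bar>x t \<bullet> b\<bar>)"

lemma linf_norm_vec:
  fixes x :: "(real ^ 'n) signal"
  shows "linf_norm x = (MAX i. SUP t. \<bar>x t $ i\<bar>)"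
proof -
  have "(\<lambda>b. SUP t. \<bar>x t \<bullet> b\<bar>) ` Basis = range (\<lambda>i. SUP t. \<bar>x t $ i\<bar>)"
    by (auto simp: Basis_vec_def inner_axis image_iff)
  then show ?thesis
    by (simp add: linf_norm_def)
qed

lemma linf_norm_Pair:
  fixes x :: "'a::euclidean_space signal" and y :: "'b::euclidean_space signal"
  shows "linf_norm (\<lambda>t. (x t, y t)) = max (linf_norm x) (linf_norm y)"
  unfolding linf_norm_def Basis_prod_def
  by (simp add: image_Un image_image Max_Un)


section \<open>Operators\<close>

definition causal :: "('a signal \<Rightarrow> 'b signal) \<Rightarrow> bool" where
  "causal R \<longleftrightarrow> (\<forall>x y t. (\<forall>s\<le>t. x s = y s) \<longrightarrow> R x t = R y t)"

definition strictly_causal :: "('a signal \<Rightarrow> 'b signal) \<Rightarrow> bool" where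
  "strictly_causal R \<longleftrightarrow> (\<forall>x y t. (\<forall>s<t. x s = y s) \<longrightarrow> R x t = R y t)"

definition shift_right :: "'a::zero signal \<Rightarrow> 'a signal" (\<open>S\<^sub>+\<close>) where
  "S\<^sub>+ x = (\<lambda>t. case t of 0 \<Rightarrow> 0 | Suc s \<Rightarrow> x s)"

definition shift_left :: "'a signal \<Rightarrow> 'a signal" (\<open>S\<^sub>-\<close>) where
  "S\<^sub>- x = (\<lambda>t. x (Suc t))"

definition induced_norm ::
    "('a::euclidean_space signal \<Rightarrow> 'b::euclidean_space signal) \<Rightarrow> ereal" where
  "induced_norm R = (SUP x\<in>{x \<in> linf. linf_norm x \<le> 1}. ereal (linf_norm (R x)))"

text \<open>A causal linear operator on the bounded signals extends uniquely to a causal linear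
  operator on all signals, because the output at time \<open>t\<close> only depends on the input truncated
  after \<open>t\<close>, which is bounded. The elements of \<open>L_TV\<close> are identified with these
  extensions, so membership in \<open>L_TV\<close> and stability of a linear map between extended
  spaces are one notion.\<close>

definition L_TV :: "('a::euclidean_space signal \<Rightarrow> 'b::euclidean_space signal) set" where
  "L_TV = {R. linear R \<and> causal R \<and> (\<forall>x\<in>linf. R x \<in> linf) \<and> induced_norm R < \<infinity>}"

abbreviation linf_stable :: "('a::euclidean_space signal \<Rightarrow> 'b::euclidean_space signal) \<Rightarrow> bool" where
  "linf_stable R \<equiv> R \<in> L_TV"

text \<open>Block operators \<open>[R T]\<close> and \<open>[R; T]\<close>.\<close>

definition block_row ::
    "('a signal \<Rightarrow> 'c::plus signal) \<Rightarrow> ('b signal \<Rightarrow> 'c signal) \<Rightarrow> ('a \<times> 'b) signal \<Rightarrow> 'c signal" where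
  "block_row R T z = R (fst \<circ> z) + T (snd \<circ> z)"

definition block_col ::
    "('a signal \<Rightarrow> 'b signal) \<Rightarrow> ('a signal \<Rightarrow> 'c signal) \<Rightarrow> 'a signal \<Rightarrow> ('b \<times> 'c) signal" where
  "block_col R T x = (\<lambda>t. (R x t, T x t))"


section \<open>The interconnection\<close>

context
  fixes A :: "(real ^ 'n) signal \<Rightarrow> (real ^ 'n) signal"
    and B :: "(real ^ 'p) signal \<Rightarrow> (real ^ 'n) signal"
    and Phi_x :: "(real ^ 'n) signal \<Rightarrow> (real ^ 'n) signal"
    and Phi_u :: "(real ^ 'n) signal \<Rightarrow> (real ^ 'p) signal"
begin

text \<open>The last equation is required only for \<open>t \<ge> 1\<close>. At \<open>t = 0\<close> it would force
  \<open>\<delta>\<^sub>y 0 = 0\<close>, and the initial condition on \<open>w_hat\<close> takes its place.\<close>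

definition interconnection ::
    "(real ^ 'n) signal \<Rightarrow> (real ^ 'n) signal \<Rightarrow> (real ^ 'p) signal \<Rightarrow>
     (real ^ 'n) signal \<Rightarrow> (real ^ 'p) signal \<Rightarrow> (real ^ 'n) signal \<Rightarrow> bool" where
  "interconnection w \<delta>y \<delta>u x u w_hat \<longleftrightarrow>
     x = S\<^sub>+ (A x) + S\<^sub>+ (B u) + S\<^sub>+ w \<and> x 0 = 0 \<and>
     u = Phi_u (S\<^sub>- w_hat) + \<delta>u \<and>
     w_hat 0 = 0 \<and>
     (\<forall>t\<ge>1. w_hat t = (x + \<delta>y + (id - (Phi_x \<circ> S\<^sub>-)) w_hat) t)"

definition well_posed :: bool where
  "well_posed \<longleftrightarrow> (\<forall>w \<delta>y \<delta>u. \<exists>!z. case z of (x, u, w_hat) \<Rightarrow> interconnection w \<delta>y \<delta>u x u w_hat)"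

text \<open>The map \<open>(w, \<delta>y, \<delta>u) \<mapsto> (x, u, w_hat)\<close>. Meaningful only if well posed.\<close>

definition response_map ::
    "((real ^ 'n) \<times> (real ^ 'n) \<times> (real ^ 'p)) signal \<Rightarrow>
     ((real ^ 'n) \<times> (real ^ 'p) \<times> (real ^ 'n)) signal" where
  "response_map d = (THE z. interconnection (fst \<circ> d) (fst \<circ> snd \<circ> d) (snd \<circ> snd \<circ> d)
                                            (fst \<circ> z) (fst \<circ> snd \<circ> z) (snd \<circ> snd \<circ> z))"

definition interconnection_stable :: bool where
  "interconnection_stable \<longleftrightarrow> well_posed \<and> linf_stable response_map"

definition closed_loop :: "(real ^ 'n) signal \<Rightarrow> ((real ^ 'n) \<times> (real ^ 'p)) signal" where
  "closed_loop w = (\<lambda>t. case response_map (\<lambda>s. (w s, 0, 0)) t of (x, u, w_hat) \<Rightarrow> (x, u))"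

text \<open>Without perturbations this is the plant in feedback with the controller
  \<open>u = Phi_u (S\<^sub>- w_hat)\<close>, \<open>w_hat = x - x_hat\<close>, \<open>x_hat = (Phi_x S\<^sub>- - I) w_hat\<close>.\<close>

lemma interconnection_unperturbed:
  assumes "linear Phi_x" "strictly_causal Phi_x"
  shows "interconnection w 0 0 x u w_hat \<longleftrightarrow>
     x = S\<^sub>+ (A x) + S\<^sub>+ (B u) + S\<^sub>+ w \<and> x 0 = 0 \<and>
     (\<exists>x_hat. u = Phi_u (S\<^sub>- w_hat) \<and> w_hat = x - x_hat \<and> w_hat 0 = 0 \<and>
              x_hat = ((Phi_x \<circ> S\<^sub>-) - id) w_hat)"
proof -
  have "Phi_x 0 = 0"
    using assms(1) by (rule linear_0)
  then have 0: "Phi_x v 0 = 0" for v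
    using assms(2) unfolding strictly_causal_def
    by (metis less_nat_zero_code zero_fun_apply)
  have 1: "(\<forall>t\<ge>1. w_hat t = (x + 0 + (id - (Phi_x \<circ> S\<^sub>-)) w_hat) t) \<longleftrightarrow>
        w_hat = x - ((Phi_x \<circ> S\<^sub>-) - id) w_hat" if "x 0 = 0" "w_hat 0 = 0"
  proof
    assume *: "\<forall>t\<ge>1. w_hat t = (x + 0 + (id - (Phi_x \<circ> S\<^sub>-)) w_hat) t"
    show "w_hat = x - ((Phi_x \<circ> S\<^sub>-) - id) w_hat"
    proof
      fix t
      show "w_hat t = (x - ((Phi_x \<circ> S\<^sub>-) - id) w_hat) t"
        using * that 0 by (cases t) (auto simp: algebra_simps)
    qed
  next
    assume *: "w_hat = x - ((Phi_x \<circ> S\<^sub>-) - id) w_hat"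
    show "\<forall>t\<ge>1. w_hat t = (x + 0 + (id - (Phi_x \<circ> S\<^sub>-)) w_hat) t"
      using fun_cong[OF *] by (simp add: algebra_simps)
  qed
  show ?thesis
    unfolding interconnection_def using 1 by auto
qed

end

end

(* With v = S_- w_hat, strict causality of Phi_x turns the controller equations into
   x = Phi_x v - S_+ S_- dy and u = Phi_u v + du. Substituting these into the plant equation and
   cancelling the injective S_+ leaves (I - \<Delta>) v = w + S_- dy - A S_+ S_- dy + B du,
   which has exactly one solution because v = g + \<Delta> v is a fixed point equation for a strictly
   causal map. Although S_- is not causal, v enters the response only through S_+, Phi_x and
   Phi_u, all strictly causal, so the response is causal. Conversely (I - \<Delta>)^-1 w is S_-
   applied to the component w_hat of the response to (w, 0, 0). *)
theory Submission
  imports Defs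
begin

section \<open>Strictly causal maps: fixed points and inversion of \<open>id - D\<close>\<close>

lemma scaleR_fun_apply: "(c *\<^sub>R f) x = c *\<^sub>R f x"
  by (simp add: scaleR_fun_def)

lemma strictly_causalD:
  assumes "strictly_causal R" "\<And>s. s < t \<Longrightarrow> x s = y s"
  shows "R x t = R y t"
  by (rule assms(1)[unfolded strictly_causal_def, THEN spec, THEN spec, THEN spec, THEN mp])
    (simp add: assms(2))

lemma causalD:
  assumes "causal R" "\<And>s. s \<le> t \<Longrightarrow> x s = y s"
  shows "R x t = R y t"
  by (rule assms(1)[unfolded causal_def, THEN spec, THEN spec, THEN spec, THEN mp])
    (simp add: assms(2))

text \<open>Each application of \<open>F\<close> settles one more time instant, whatever the
  starting signal, so the iterates converge after finitely many steps at every fixed time.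
  Uniqueness is strong induction on time.\<close>

lemma strictly_causal_fixpoint_ex1:
  fixes F :: "'a signal \<Rightarrow> 'a signal"
  assumes F: "strictly_causal F"
  shows "\<exists>!v. F v = v"
proof
  fix z :: "'a signal"
  \<comment> \<open>At time \<open>t\<close> all iterates of index greater than \<open>t\<close>
    agree. Such indices are positive, so one \<open>F\<close> can be peeled off both sides, and
    strict causality passes to earlier times.\<close>
  have stab: "(F ^^ m) z t = (F ^^ n) z t" if "t < m" "t < n" for m n t
    using that
  proof (induction t arbitrary: m n rule: less_induct)
    case (less t)
    obtain m' n' where mn: "m = Suc m'" "n = Suc n'"
      using less.prems by (cases m; cases n) auto
    have "F ((F ^^ m') z) t = F ((F ^^ n') z) t"
      by (rule strictly_causalD[OF F], rule less.IH) (use less.prems mn in simp_all)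
    then show ?case by (simp add: mn)
  qed
  \<comment> \<open>Diagonal choice: iterate \<open>Suc t\<close> is the first one that
    \<open>stab\<close> guarantees to be settled at time \<open>t\<close>. It equals
    \<open>F\<close> applied to iterate \<open>t\<close>, which agrees with \<open>v\<close> before
    \<open>t\<close>.\<close>
  define v where "v = (\<lambda>t. (F ^^ Suc t) z t)"
  show "F v = v"
  proof
    fix t
    have "F v t = F ((F ^^ t) z) t"
      unfolding v_def by (intro strictly_causalD[OF F] stab) auto
    then show "F v t = v t" by (simp add: v_def)
  qed
  fix v' assume v': "F v' = v'"
  have "v' t = v t" for t
  proof (induction t rule: less_induct)
    case (less t)
    have "F v' t = F v t" by (rule strictly_causalD[OF F less.IH])
    then show ?case using v' \<open>F v = v\<close> by metis
  qed
  then show "v' = v" ..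
qed

text \<open>Preimages of \<open>g\<close> are the fixed points of the strictly causal map
  \<open>v \<mapsto> g + D v\<close>; their existence gives surjectivity and their uniqueness
  injectivity.\<close>

lemma bij_id_minus_strictly_causal:
  fixes D :: "'a::ab_group_add signal \<Rightarrow> 'a signal"
  assumes "strictly_causal D"
  shows "bij (id - D)"
proof (rule bijI')
  have ex1: "\<exists>!v. g + D v = v" for g
  proof (rule strictly_causal_fixpoint_ex1)
    show "strictly_causal (\<lambda>v. g + D v)"
      unfolding strictly_causal_def
    proof (intro allI impI)
      fix x y :: "'a signal" and t
      assume "\<forall>s<t. x s = y s"
      then have "D x t = D y t"
        by (intro strictly_causalD[OF assms]) simp
      then show "(g + D x) t = (g + D y) t" by simp
    qed
  qed
  have iff: "(id - D) v = g \<longleftrightarrow> g + D v = v" for v g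
    by (simp only: minus_apply id_apply diff_eq_eq) (rule eq_commute)
  fix g show "\<exists>v. g = (id - D) v"
    using ex1[of g] iff by metis
  fix v v' show "((id - D) v = (id - D) v') = (v = v')"
    using ex1[of "(id - D) v'"] iff by metis
qed

text \<open>The preimage \<open>v\<close> of \<open>g\<close> satisfies
  \<open>v t = g t + D v t\<close>, where \<open>D v t\<close> sees only earlier values of
  \<open>v\<close>; induction on time traces these back to \<open>g\<close> up to time
  \<open>t\<close>.\<close>

lemma causal_inv_id_minus:
  fixes D :: "'a::ab_group_add signal \<Rightarrow> 'a signal"
  assumes D: "strictly_causal D"
  shows "causal (inv (id - D))"
  unfolding causal_def
proof (intro allI impI)
  fix x y :: "'a signal" and t
  assume xy: "\<forall>s\<le>t. x s = y s"
  have "inv (id - D) g = g + D (inv (id - D) g)" for g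
    using surj_f_inv_f[OF bij_is_surj[OF bij_id_minus_strictly_causal[OF D]], of g]
    by (simp only: minus_apply id_apply diff_eq_eq)
  then have eq: "inv (id - D) g s = g s + D (inv (id - D) g) s" for g s
    by (metis plus_fun_apply)
  show "inv (id - D) x t = inv (id - D) y t"
    using xy
  proof (induction t rule: less_induct)
    case (less t)
    have "D (inv (id - D) x) t = D (inv (id - D) y) t"
      by (rule strictly_causalD[OF D], rule less.IH) (use less.prems in auto)
    moreover have "x t = y t" using less.prems by simp
    ultimately show ?case using eq by metis
  qed
qed

lemma linear_inv_of_bij:
  assumes "linear f" "bij f"
  shows "linear (inv f)"
proof (rule linearI)
  have surj: "f (inv f y) = y" for y
    using assms(2) by (simp add: bij_is_surj surj_f_inv_f)
  have inj: "inj f" using assms(2) by (rule bij_is_inj)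
  fix x y c
  show "inv f (x + y) = inv f x + inv f y"
    by (rule inv_f_eq[OF inj]) (simp add: linear_add[OF assms(1)] surj)
  show "inv f (c *\<^sub>R x) = c *\<^sub>R inv f x"
    by (rule inv_f_eq[OF inj]) (simp add: linear_scale[OF assms(1)] surj)
qed

section \<open>Boundedness in terms of pointwise Euclidean norms\<close>

lemma component_le_linf_norm:
  assumes "x \<in> linf" "b \<in> Basis"
  shows "\<bar>x t \<bullet> b\<bar> \<le> linf_norm x"
proof -
  obtain c where c: "norm (x t) \<le> c" for t
    using assms(1) by (auto simp: linf_def bounded_iff)
  have "\<bar>x t \<bullet> b\<bar> \<le> (SUP t. \<bar>x t \<bullet> b\<bar>)"
    by (rule cSUP_upper) (auto intro!: bdd_aboveI2[of _ _ c] Basis_le_norm[THEN order_trans] assms c)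
  also have "\<dots> \<le> linf_norm x"
    unfolding linf_norm_def using assms(2) by (intro Max_ge) auto
  finally show ?thesis .
qed

lemma norm_le_linf_norm:
  fixes x :: "'a::euclidean_space signal"
  assumes "x \<in> linf"
  shows "norm (x t) \<le> DIM('a) * linf_norm x"
proof -
  have "norm (x t) \<le> (\<Sum>b\<in>Basis. \<bar>x t \<bullet> b\<bar>)" by (rule norm_le_l1)
  also have "\<dots> \<le> DIM('a) * linf_norm x"
    using sum_bounded_above[of "Basis :: 'a set" "\<lambda>b. \<bar>x t \<bullet> b\<bar>" "linf_norm x"]
      component_le_linf_norm[OF assms] by simp
  finally show ?thesis .
qed

lemma linf_norm_le:
  assumes "\<And>t. norm (x t) \<le> c"
  shows "linf_norm x \<le> c"
  unfolding linf_norm_def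
  by (subst Max_le_iff) (auto intro!: cSUP_least Basis_le_norm[THEN order_trans] assms)

text \<open>The quantitative half of \<open>L_TV\<close> without causality, so that it also covers
  \<open>S\<^sub>-\<close>, which is not causal. Pointwise Euclidean bounds replace suprema of
  components, which makes closure under composition, sums and pairing direct.\<close>

definition bounded_operator ::
    "('a::euclidean_space signal \<Rightarrow> 'b::euclidean_space signal) \<Rightarrow> bool" where
  "bounded_operator R \<longleftrightarrow> linear R \<and>
     (\<exists>K. \<forall>x c. (\<forall>t. norm (x t) \<le> c) \<longrightarrow> (\<forall>t. norm (R x t) \<le> K * c))"

lemma bounded_operatorI:
  assumes "linear R" "\<And>x c t. (\<And>t. norm (x t) \<le> c) \<Longrightarrow> norm (R x t) \<le> K * c"
  shows "bounded_operator R"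
  using assms unfolding bounded_operator_def by blast

lemma bounded_operator_linear: "bounded_operator R \<Longrightarrow> linear R"
  by (simp add: bounded_operator_def)

text \<open>The largest component and the Euclidean norm differ at most by a factor of the
  dimension, so both ways of measuring signals give the same bounded operators.\<close>

lemma L_TV_iff:
  fixes R :: "'a::euclidean_space signal \<Rightarrow> 'b::euclidean_space signal"
  shows "R \<in> L_TV \<longleftrightarrow> bounded_operator R \<and> causal R"
proof
  assume R: "R \<in> L_TV"
  then have lin: "linear R" by (simp add: L_TV_def)
  have "induced_norm R < \<infinity>" using R by (simp add: L_TV_def)
  then obtain K where K: "induced_norm R \<le> ereal K"
    by (cases "induced_norm R") auto
  \<comment> \<open>A pointwise Euclidean bound of 1 puts \<open>x\<close> in the unit ball of
    \<open>linf_norm\<close>, where the induced norm applies; the factor \<open>DIM('b)\<close>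
    converts the output back to Euclidean norm.\<close>
  have unit: "norm (R x t) \<le> DIM('b) * K" if "\<And>t. norm (x t) \<le> 1" for x t
  proof -
    have x: "x \<in> linf" "linf_norm x \<le> 1"
      using that linf_norm_le[of x 1] by (auto simp: linf_def bounded_iff)
    then have "ereal (linf_norm (R x)) \<le> induced_norm R"
      unfolding induced_norm_def by (intro SUP_upper) simp
    with K have "linf_norm (R x) \<le> K" by (meson ereal_less_eq(3) order_trans)
    moreover have "R x \<in> linf" using R x by (simp add: L_TV_def)
    ultimately show ?thesis
      by (meson norm_le_linf_norm mult_left_mono of_nat_0_le_iff order_trans)
  qed
  have "norm (R x t) \<le> (DIM('b) * K) * c" if x: "\<And>t. norm (x t) \<le> c" for x c t
  \<comment> \<open>The general bound follows by rescaling to the unit ball. This divides by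
    \<open>c\<close>, so \<open>c = 0\<close>, which forces the zero signal, is treated apart;
    otherwise \<open>c > 0\<close> since it bounds a norm.\<close>
  proof (cases "c = 0")
    case True
    then have "x = 0" using x by (auto simp: fun_eq_iff)
    then show ?thesis using True by (simp add: linear_0[OF lin])
  next
    case False
    then have c: "c > 0" using x[of 0] norm_ge_zero[of "x 0"] by linarith
    have "norm (R (inverse c *\<^sub>R x) t) \<le> DIM('b) * K"
      using x c by (intro unit) (simp add: scaleR_fun_apply field_simps)
    moreover have "norm (R (inverse c *\<^sub>R x) t) = norm (R x t) / c"
      unfolding linear_scale[OF lin] using c by (simp add: scaleR_fun_apply field_simps)
    ultimately have "norm (R x t) / c \<le> DIM('b) * K" by metis
    then show ?thesis by (simp only: pos_divide_le_eq[OF c])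
  qed
  with lin have "bounded_operator R" by (rule bounded_operatorI)
  then show "bounded_operator R \<and> causal R" using R by (simp add: L_TV_def)
next
  assume R: "bounded_operator R \<and> causal R"
  obtain K where K: "\<And>x c t. (\<And>t. norm (x t) \<le> c) \<Longrightarrow> norm (R x t) \<le> K * c"
    using R unfolding bounded_operator_def by metis
  have "R x \<in> linf" if x: "x \<in> linf" for x
  proof -
    obtain c where "norm (x t) \<le> c" for t
      using x by (auto simp: linf_def bounded_iff)
    then have "norm (R x t) \<le> K * c" for t by (rule K)
    then show ?thesis by (auto simp: linf_def bounded_iff)
  qed
  \<comment> \<open>The unit ball of \<open>linf_norm\<close> lies in the set of signals with
    Euclidean bound \<open>DIM('a)\<close>, hence this factor.\<close>
  moreover have "induced_norm R \<le> ereal (K * DIM('a))"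
    unfolding induced_norm_def
  proof (rule SUP_least)
    fix x :: "'a signal" assume x: "x \<in> {x \<in> linf. linf_norm x \<le> 1}"
    have "norm (x t) \<le> DIM('a)" for t
    proof -
      have "norm (x t) \<le> DIM('a) * linf_norm x" using x by (simp add: norm_le_linf_norm)
      also have "\<dots> \<le> real DIM('a) * 1" using x by (intro mult_left_mono) auto
      finally show ?thesis by simp
    qed
    then have "linf_norm (R x) \<le> K * DIM('a)" by (intro linf_norm_le K)
    then show "ereal (linf_norm (R x)) \<le> ereal (K * DIM('a))" by simp
  qed
  then have "induced_norm R < \<infinity>" by (rule le_less_trans) simp
  ultimately show "R \<in> L_TV"
    using R by (simp add: L_TV_def bounded_operator_linear)
qed

lemma bounded_operator_compose:
  assumes "bounded_operator R" "bounded_operator T"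
  shows "bounded_operator (\<lambda>x. R (T x))"
proof -
  obtain K where K: "\<And>x c t. (\<And>t. norm (x t) \<le> c) \<Longrightarrow> norm (R x t) \<le> K * c"
    using assms(1) unfolding bounded_operator_def by metis
  obtain L where L: "\<And>x c t. (\<And>t. norm (x t) \<le> c) \<Longrightarrow> norm (T x t) \<le> L * c"
    using assms(2) unfolding bounded_operator_def by metis
  have "linear (\<lambda>x. R (T x))"
    using linear_compose[of T R] assms by (simp add: o_def bounded_operator_linear)
  then show ?thesis
    by (rule bounded_operatorI[where K = "K * L"]) (simp add: K L mult.assoc)
qed

lemma bounded_operator_add:
  assumes "bounded_operator R" "bounded_operator T"
  shows "bounded_operator (\<lambda>x. R x + T x)"
proof -
  obtain K where K: "\<And>x c t. (\<And>t. norm (x t) \<le> c) \<Longrightarrow> norm (R x t) \<le> K * c"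
    using assms(1) unfolding bounded_operator_def by metis
  obtain L where L: "\<And>x c t. (\<And>t. norm (x t) \<le> c) \<Longrightarrow> norm (T x t) \<le> L * c"
    using assms(2) unfolding bounded_operator_def by metis
  show ?thesis
  proof (rule bounded_operatorI[where K = "K + L"])
    show "linear (\<lambda>x. R x + T x)"
      using assms by (intro linear_compose_add bounded_operator_linear)
    fix x :: "'a signal" and c t assume "\<And>t. norm (x t) \<le> c"
    then show "norm ((R x + T x) t) \<le> (K + L) * c"
      unfolding plus_fun_apply distrib_right by (intro norm_triangle_mono K L)
  qed
qed

lemma bounded_operator_uminus:
  assumes "bounded_operator R"
  shows "bounded_operator (\<lambda>x. - R x)"
proof -
  obtain K where K: "\<And>x c t. (\<And>t. norm (x t) \<le> c) \<Longrightarrow> norm (R x t) \<le> K * c"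
    using assms unfolding bounded_operator_def by metis
  show ?thesis
    by (rule bounded_operatorI[where K = K])
      (use assms in \<open>simp_all add: linear_compose_neg bounded_operator_linear K\<close>)
qed

lemma bounded_operator_diff:
  assumes "bounded_operator R" "bounded_operator T"
  shows "bounded_operator (\<lambda>x. R x - T x)"
  using bounded_operator_add[OF assms(1) bounded_operator_uminus[OF assms(2)]] by simp

lemma bounded_operator_Pair:
  assumes "bounded_operator R" "bounded_operator T"
  shows "bounded_operator (\<lambda>x t. (R x t, T x t))"
proof -
  obtain K where K: "\<And>x c t. (\<And>t. norm (x t) \<le> c) \<Longrightarrow> norm (R x t) \<le> K * c"
    using assms(1) unfolding bounded_operator_def by metis
  obtain L where L: "\<And>x c t. (\<And>t. norm (x t) \<le> c) \<Longrightarrow> norm (T x t) \<le> L * c"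
    using assms(2) unfolding bounded_operator_def by metis
  show ?thesis
  proof (rule bounded_operatorI[where K = "K + L"])
    show "linear (\<lambda>x t. (R x t, T x t))"
      using assms[THEN bounded_operator_linear]
      by (auto intro!: linearI simp: fun_eq_iff scaleR_fun_apply linear_add linear_scale)
    fix x :: "'a signal" and c t assume "\<And>t. norm (x t) \<le> c"
    then have "norm (R x t) \<le> K * c" "norm (T x t) \<le> L * c"
      by (auto intro: K L)
    then show "norm (R x t, T x t) \<le> (K + L) * c"
      using norm_Pair_le[of "R x t" "T x t"] by (simp add: distrib_right)
  qed
qed

text \<open>Supplies the coordinate projections of tuple signals and the embedding of
  \<open>w\<close> as \<open>(w, 0, 0)\<close>.\<close>

lemma bounded_operator_pointwise:
  assumes f: "bounded_linear f"
  shows "bounded_operator (\<lambda>x. f \<circ> x)"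
proof -
  interpret bounded_linear f by (rule f)
  obtain K where K: "0 \<le> K" "\<And>x. norm (f x) \<le> norm x * K"
    using nonneg_bounded by blast
  show ?thesis
  proof (rule bounded_operatorI[where K = K])
    show "linear (\<lambda>x. f \<circ> x)"
      by (auto intro!: linearI simp: fun_eq_iff scaleR_fun_apply add scale)
    fix x :: "'a signal" and c t assume x: "\<And>t. norm (x t) \<le> c"
    have "norm (f (x t)) \<le> K * norm (x t)" using K(2) by (simp add: mult.commute)
    also have "\<dots> \<le> K * c" using x K(1) by (rule mult_left_mono)
    finally show "norm ((f \<circ> x) t) \<le> K * c" by simp
  qed
qed

section \<open>Shifts and the solution of the loop equations\<close>

lemma shift_right_simps [simp]: "S\<^sub>+ x 0 = 0" "S\<^sub>+ x (Suc t) = x t"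
  by (simp_all add: shift_right_def)

lemma shift_left_apply [simp]: "S\<^sub>- x t = x (Suc t)"
  by (simp add: shift_left_def)

lemma shift_left_right [simp]: "S\<^sub>- (S\<^sub>+ x) = x"
  by (simp add: fun_eq_iff)

text \<open>In general \<open>S\<^sub>+ (S\<^sub>- x)\<close> is \<open>x\<close> with its entry at
  time 0 replaced by 0. The condition \<open>w_hat 0 = 0\<close> therefore lets \<open>w_hat\<close>
  be recovered from \<open>S\<^sub>- w_hat\<close>.\<close>

lemma shift_right_left: "x 0 = 0 \<Longrightarrow> S\<^sub>+ (S\<^sub>- x) = x"
  by (simp add: fun_eq_iff shift_right_def split: nat.split)

lemma linear_shift_right: "linear (S\<^sub>+ :: 'a::real_vector signal \<Rightarrow> 'a signal)"
  by (rule linearI) (auto simp: fun_eq_iff shift_right_def scaleR_fun_apply split: nat.split)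

lemma linear_shift_left: "linear (S\<^sub>- :: 'a::real_vector signal \<Rightarrow> 'a signal)"
  by (rule linearI) (auto simp: fun_eq_iff scaleR_fun_apply)

lemma bounded_operator_shift_right: "bounded_operator S\<^sub>+"
proof (rule bounded_operatorI[where K = 1, OF linear_shift_right])
  fix x :: "'a signal" and c t assume x: "\<And>t. norm (x t) \<le> c"
  then have "0 \<le> c" using norm_ge_zero order_trans by blast
  then show "norm (S\<^sub>+ x t) \<le> 1 * c" using x by (cases t) auto
qed

lemma bounded_operator_shift_left: "bounded_operator S\<^sub>-"
  by (rule bounded_operatorI[where K = 1, OF linear_shift_left]) simp

text \<open>No time precedes 0, so at time 0 every input gives the same output as the zero
  signal.\<close>

lemma strictly_causal_linear_0:
  assumes "strictly_causal R" "linear R"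
  shows "R v 0 = 0"
  using strictly_causalD[OF assms(1), of 0 v 0] linear_0[OF assms(2)] by simp

text \<open>The single disturbance that drives \<open>v = S\<^sub>- w_hat\<close> exactly as
  \<open>w\<close>, \<open>\<delta>y\<close> and \<open>\<delta>u\<close> do together. The two terms
  in \<open>\<delta>y\<close> come from the offset \<open>- S\<^sub>+ (S\<^sub>- \<delta>y)\<close>
  in \<open>x\<close>, once directly and once through \<open>A\<close>; the entry of
  \<open>\<delta>y\<close> at time 0 drops out.\<close>

definition effective_input ::
    "('a::group_add signal \<Rightarrow> 'a signal) \<Rightarrow> ('b signal \<Rightarrow> 'a signal) \<Rightarrow>
     'a signal \<Rightarrow> 'a signal \<Rightarrow> 'b signal \<Rightarrow> 'a signal" where
  "effective_input A B w \<delta>y \<delta>u = w + S\<^sub>- \<delta>y - A (S\<^sub>+ (S\<^sub>- \<delta>y)) + B \<delta>u"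

text \<open>Parametrises all solutions of the loop by \<open>v\<close>, so that solving three
  coupled equations becomes inverting \<open>id - D\<close>.\<close>

lemma interconnection_iff:
  fixes A :: "(real ^ 'n) signal \<Rightarrow> (real ^ 'n) signal"
    and B :: "(real ^ 'p) signal \<Rightarrow> (real ^ 'n) signal"
  assumes A: "linear A" and B: "linear B"
    and Phi_x: "linear Phi_x" "strictly_causal Phi_x"
    and eq: "block_row (id - (S\<^sub>+ \<circ> A)) (- (S\<^sub>+ \<circ> B)) \<circ> block_col Phi_x Phi_u = S\<^sub>+ \<circ> (id - D)"
  shows "interconnection A B Phi_x Phi_u w \<delta>y \<delta>u x u w_hat \<longleftrightarrow>
    (\<exists>v. (id - D) v = effective_input A B w \<delta>y \<delta>u \<and>
         x = Phi_x v - S\<^sub>+ (S\<^sub>- \<delta>y) \<and> u = Phi_u v + \<delta>u \<and> w_hat = S\<^sub>+ v)"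
proof -
  note S = linear_add[OF linear_shift_right] linear_diff[OF linear_shift_right]
  have Phi: "Phi_x v - S\<^sub>+ (A (Phi_x v)) - S\<^sub>+ (B (Phi_u v)) = S\<^sub>+ ((id - D) v)" for v
    using fun_cong[OF eq, of v]
    by (simp add: block_row_def block_col_def comp_def)
  \<comment> \<open>For \<open>x\<close> and \<open>u\<close> of this form, the residual of the
    plant equation is \<open>S\<^sub>+\<close> of one side of the equation for \<open>v\<close>
    minus \<open>S\<^sub>+\<close> of the other; applying \<open>S\<^sub>-\<close> cancels the
    shift.\<close>
  have plant: "x = S\<^sub>+ (A x) + S\<^sub>+ (B u) + S\<^sub>+ w \<longleftrightarrow> (id - D) v = effective_input A B w \<delta>y \<delta>u"
    if x: "x = Phi_x v - S\<^sub>+ (S\<^sub>- \<delta>y)" and u: "u = Phi_u v + \<delta>u" for v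
  proof -
    have "x - S\<^sub>+ (A x) - S\<^sub>+ (B u) - S\<^sub>+ w
        = (Phi_x v - S\<^sub>+ (A (Phi_x v)) - S\<^sub>+ (B (Phi_u v))) - S\<^sub>+ (effective_input A B w \<delta>y \<delta>u)"
      unfolding x u effective_input_def
      by (simp add: linear_add[OF B] linear_diff[OF A] S)
    also have "\<dots> = S\<^sub>+ ((id - D) v) - S\<^sub>+ (effective_input A B w \<delta>y \<delta>u)"
      by (simp only: Phi)
    finally have diff: "x - S\<^sub>+ (A x) - S\<^sub>+ (B u) - S\<^sub>+ w =
        S\<^sub>+ ((id - D) v) - S\<^sub>+ (effective_input A B w \<delta>y \<delta>u)" .
    have "x = S\<^sub>+ (A x) + S\<^sub>+ (B u) + S\<^sub>+ w \<longleftrightarrow> x - S\<^sub>+ (A x) - S\<^sub>+ (B u) - S\<^sub>+ w = 0"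
      by (simp only: diff_diff_eq right_minus_eq add.assoc)
    also have "\<dots> \<longleftrightarrow> S\<^sub>+ ((id - D) v) = S\<^sub>+ (effective_input A B w \<delta>y \<delta>u)"
      by (simp only: diff right_minus_eq)
    also have "\<dots> \<longleftrightarrow> (id - D) v = effective_input A B w \<delta>y \<delta>u"
      by (metis shift_left_right)
    finally show ?thesis .
  qed
  \<comment> \<open>For \<open>t \<ge> 1\<close> the term \<open>w_hat t\<close> cancels from both
    sides of the controller equation. At time 0 both \<open>Phi_x\<close> and
    \<open>S\<^sub>+\<close> output 0, so the condition \<open>x 0 = 0\<close> completes these to
    one equation between signals.\<close>
  have estimate: "x 0 = 0 \<and> (\<forall>t\<ge>1. w_hat t = (x + \<delta>y + (id - (Phi_x \<circ> S\<^sub>-)) w_hat) t) \<longleftrightarrow>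
      x = Phi_x (S\<^sub>- w_hat) - S\<^sub>+ (S\<^sub>- \<delta>y)"
  proof -
    have pt: "w_hat t = (x + \<delta>y + (id - (Phi_x \<circ> S\<^sub>-)) w_hat) t \<longleftrightarrow>
        x t = Phi_x (S\<^sub>- w_hat) t - \<delta>y t" for t
    proof -
      have "(x + \<delta>y + (id - (Phi_x \<circ> S\<^sub>-)) w_hat) t =
          w_hat t + (x t - (Phi_x (S\<^sub>- w_hat) t - \<delta>y t))"
        by simp
      then show ?thesis by (simp only: add_cancel_right_right right_minus_eq)
    qed
    note 0 = strictly_causal_linear_0[OF Phi_x(2,1)]
    show ?thesis
      unfolding pt
    proof
      assume *: "x 0 = 0 \<and> (\<forall>t\<ge>1. x t = Phi_x (S\<^sub>- w_hat) t - \<delta>y t)"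
      show "x = Phi_x (S\<^sub>- w_hat) - S\<^sub>+ (S\<^sub>- \<delta>y)"
      proof
        fix t
        show "x t = (Phi_x (S\<^sub>- w_hat) - S\<^sub>+ (S\<^sub>- \<delta>y)) t"
          using * 0 by (cases t) auto
      qed
    next
      assume *: "x = Phi_x (S\<^sub>- w_hat) - S\<^sub>+ (S\<^sub>- \<delta>y)"
      have "x t = Phi_x (S\<^sub>- w_hat) t - \<delta>y t" if "t \<ge> 1" for t
        using that by (cases t) (simp_all add: *)
      then show "x 0 = 0 \<and> (\<forall>t\<ge>1. x t = Phi_x (S\<^sub>- w_hat) t - \<delta>y t)"
        by (simp add: * 0)
    qed
  qed
  show ?thesis
  proof
    assume "interconnection A B Phi_x Phi_u w \<delta>y \<delta>u x u w_hat"
    then have *: "x = S\<^sub>+ (A x) + S\<^sub>+ (B u) + S\<^sub>+ w" "u = Phi_u (S\<^sub>- w_hat) + \<delta>u"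
        "x = Phi_x (S\<^sub>- w_hat) - S\<^sub>+ (S\<^sub>- \<delta>y)" "S\<^sub>+ (S\<^sub>- w_hat) = w_hat"
      unfolding interconnection_def using estimate by (blast intro: shift_right_left)+
    with plant[OF *(3,2)] show "\<exists>v. (id - D) v = effective_input A B w \<delta>y \<delta>u \<and>
         x = Phi_x v - S\<^sub>+ (S\<^sub>- \<delta>y) \<and> u = Phi_u v + \<delta>u \<and> w_hat = S\<^sub>+ v"
      by metis
  next
    assume "\<exists>v. (id - D) v = effective_input A B w \<delta>y \<delta>u \<and>
         x = Phi_x v - S\<^sub>+ (S\<^sub>- \<delta>y) \<and> u = Phi_u v + \<delta>u \<and> w_hat = S\<^sub>+ v"
    then obtain v where v: "(id - D) v = effective_input A B w \<delta>y \<delta>u"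
        "x = Phi_x v - S\<^sub>+ (S\<^sub>- \<delta>y)" "u = Phi_u v + \<delta>u" "w_hat = S\<^sub>+ v"
      by blast
    have "S\<^sub>- w_hat = v" "w_hat 0 = 0" by (simp_all add: v(4))
    with v plant[OF v(2,3)] estimate show "interconnection A B Phi_x Phi_u w \<delta>y \<delta>u x u w_hat"
      unfolding interconnection_def by metis
  qed
qed

section \<open>Well-posedness, closed loop response and stability\<close>

theorem theorem3p5:
  fixes A :: "(real ^ 'n) signal \<Rightarrow> (real ^ 'n) signal"
    and B :: "(real ^ 'p) signal \<Rightarrow> (real ^ 'n) signal"
    and Phi_x :: "(real ^ 'n) signal \<Rightarrow> (real ^ 'n) signal"
    and Phi_u :: "(real ^ 'n) signal \<Rightarrow> (real ^ 'p) signal"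
    and \<Delta> :: "(real ^ 'n) signal \<Rightarrow> (real ^ 'n) signal"
  assumes "A \<in> L_TV" and "B \<in> L_TV"
    and "linear Phi_x" and "strictly_causal Phi_x" and "linf_stable Phi_x"
    and "linear Phi_u" and "strictly_causal Phi_u" and "linf_stable Phi_u"
    and "linear \<Delta>" and "strictly_causal \<Delta>"
    and "block_row (id - (S\<^sub>+ \<circ> A)) (- (S\<^sub>+ \<circ> B)) \<circ> block_col Phi_x Phi_u = S\<^sub>+ \<circ> (id - \<Delta>)"
  shows "well_posed A B Phi_x Phi_u \<and>
         bij (id - \<Delta>) \<and>
         closed_loop A B Phi_x Phi_u = block_col Phi_x Phi_u \<circ> inv (id - \<Delta>) \<and>
         (interconnection_stable A B Phi_x Phi_u \<longleftrightarrow> linf_stable (inv (id - \<Delta>)))"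
proof -
  let ?M = "inv (id - \<Delta>)"
  have A: "bounded_operator A" "causal A" and B: "bounded_operator B" "causal B"
    and Phi_x: "bounded_operator Phi_x" and Phi_u: "bounded_operator Phi_u"
    using assms(1,2,5,8) by (auto simp: L_TV_iff)
  have bij: "bij (id - \<Delta>)"
    using assms(10) by (rule bij_id_minus_strictly_causal)
  have "linear (id - \<Delta>)"
    using assms(9) by (auto intro!: linearI simp: linear_add linear_scale scaleR_diff_right)
  then have lin_M: "linear ?M" using bij by (rule linear_inv_of_bij)
  have causal_M: "causal ?M" using assms(10) by (rule causal_inv_id_minus)
  \<comment> \<open>Bijectivity of \<open>id - \<Delta>\<close> leaves exactly one \<open>v\<close>,
    which turns the interconnection into explicit formulas for \<open>x\<close>, \<open>u\<close>
    and \<open>w_hat\<close>.\<close>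
  have sol: "interconnection A B Phi_x Phi_u w \<delta>y \<delta>u x u w_hat \<longleftrightarrow>
      (let v = ?M (effective_input A B w \<delta>y \<delta>u)
       in x = Phi_x v - S\<^sub>+ (S\<^sub>- \<delta>y) \<and> u = Phi_u v + \<delta>u \<and> w_hat = S\<^sub>+ v)" for w \<delta>y \<delta>u x u w_hat
  proof -
    have "(id - \<Delta>) v = g \<longleftrightarrow> v = ?M g" for v g
      using bij by (metis bij_inv_eq_iff)
    then show ?thesis
      unfolding interconnection_iff[OF A(1)[THEN bounded_operator_linear]
          B(1)[THEN bounded_operator_linear] assms(3,4,11)] Let_def by metis
  qed
  have wp: "well_posed A B Phi_x Phi_u"
    unfolding well_posed_def sol Let_def by (auto simp: split_def prod_eq_iff)
  define V where
    "V d = ?M (effective_input A B (fst \<circ> d) (fst \<circ> snd \<circ> d) (snd \<circ> snd \<circ> d))" for d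
  have response: "response_map A B Phi_x Phi_u =
      (\<lambda>d t. ((Phi_x (V d) - S\<^sub>+ (S\<^sub>- (fst \<circ> snd \<circ> d))) t,
              (Phi_u (V d) + (snd \<circ> snd \<circ> d)) t, S\<^sub>+ (V d) t))"
    unfolding response_map_def sol Let_def V_def[symmetric]
    by (rule ext, rule the_equality) (auto simp: fun_eq_iff prod_eq_iff)
  \<comment> \<open>With zero perturbations the effective input is \<open>w\<close> itself. This
    yields both the closed loop formula and the recovery of \<open>?M\<close> from the
    response.\<close>
  have V_w: "V (\<lambda>s. (w s, 0, 0)) = ?M w" for w
  proof -
    have "effective_input A B w 0 0 = w"
      using A(1) B(1)
      by (simp add: effective_input_def bounded_operator_linear linear_0
          linear_0[OF linear_shift_left] linear_0[OF linear_shift_right])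
    then show ?thesis by (simp add: V_def comp_def zero_fun_def)
  qed
  have closed_loop: "closed_loop A B Phi_x Phi_u = block_col Phi_x Phi_u \<circ> ?M"
  proof
    fix w
    have "S\<^sub>+ (S\<^sub>- (\<lambda>s. 0 :: real ^ 'n)) = (\<lambda>s. 0)"
      by (rule shift_right_left) simp
    then show "closed_loop A B Phi_x Phi_u w = (block_col Phi_x Phi_u \<circ> ?M) w"
      by (simp add: closed_loop_def response V_w block_col_def comp_def)
  qed
  have "linf_stable ?M" if stable: "linf_stable (response_map A B Phi_x Phi_u)"
  proof -
    let ?E = "\<lambda>w :: (real ^ 'n) signal. \<lambda>s. (w s, 0 :: real ^ 'n, 0 :: real ^ 'p)"
    have "bounded_operator (\<lambda>w. (\<lambda>a. (a, 0, 0)) \<circ> w :: ((real ^ 'n) \<times> (real ^ 'n) \<times> (real ^ 'p)) signal)"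
      by (intro bounded_operator_pointwise bounded_linear_Pair bounded_linear_ident bounded_linear_zero)
    then have E: "bounded_operator ?E" by (simp add: comp_def)
    have R: "bounded_operator (response_map A B Phi_x Phi_u)"
      using stable by (simp add: L_TV_iff)
    \<comment> \<open>Embed \<open>w\<close>, apply the response, project to
      \<open>w_hat = S\<^sub>+ (?M w)\<close> and undo the shift. Only boundedness is read off this
      way, since \<open>S\<^sub>-\<close> is not causal; causality is
      \<open>causal_M\<close>.\<close>
    have "bounded_operator (\<lambda>w. S\<^sub>- ((\<lambda>a. snd (snd a)) \<circ> response_map A B Phi_x Phi_u (?E w)))"
      by (rule bounded_operator_compose[OF bounded_operator_shift_left
            bounded_operator_compose[OF bounded_operator_pointwise
              [OF bounded_linear_snd_comp[OF bounded_linear_snd]]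
            bounded_operator_compose[OF R E]]])
    moreover have "S\<^sub>- ((\<lambda>a. snd (snd a)) \<circ> response_map A B Phi_x Phi_u (?E w)) = ?M w" for w
      by (simp add: fun_eq_iff response V_w)
    ultimately have "bounded_operator ?M" by simp
    then show ?thesis using causal_M by (simp add: L_TV_iff)
  qed
  moreover have "linf_stable (response_map A B Phi_x Phi_u)" if "linf_stable ?M"
  proof -
    have M: "bounded_operator ?M" using that by (simp add: L_TV_iff)
    have proj: "bounded_operator (\<lambda>d :: ((real ^ 'n) \<times> (real ^ 'n) \<times> (real ^ 'p)) signal. fst \<circ> d)"
        "bounded_operator (\<lambda>d :: ((real ^ 'n) \<times> (real ^ 'n) \<times> (real ^ 'p)) signal. fst \<circ> snd \<circ> d)"
        "bounded_operator (\<lambda>d :: ((real ^ 'n) \<times> (real ^ 'n) \<times> (real ^ 'p)) signal. snd \<circ> snd \<circ> d)"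
      by (simp_all add: comp_assoc bounded_operator_compose bounded_operator_pointwise
          bounded_linear_fst bounded_linear_snd)
    have V: "bounded_operator V"
      unfolding V_def effective_input_def
      by (intro bounded_operator_compose[OF M] bounded_operator_add bounded_operator_diff
          bounded_operator_compose[OF A(1)] bounded_operator_compose[OF B(1)]
          bounded_operator_compose[OF bounded_operator_shift_right]
          bounded_operator_compose[OF bounded_operator_shift_left] proj)
    have "bounded_operator (response_map A B Phi_x Phi_u)"
      unfolding response
      by (intro bounded_operator_Pair bounded_operator_add bounded_operator_diff
          bounded_operator_compose[OF Phi_x V] bounded_operator_compose[OF Phi_u V]
          bounded_operator_compose[OF bounded_operator_shift_right]
          bounded_operator_compose[OF bounded_operator_shift_left] V proj)
    moreover have "causal (response_map A B Phi_x Phi_u)"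
      unfolding causal_def
    proof (intro allI impI)
      fix d e :: "((real ^ 'n) \<times> (real ^ 'n) \<times> (real ^ 'p)) signal" and t
      assume de: "\<forall>s\<le>t. d s = e s"
      \<comment> \<open>\<open>V\<close> looks one step ahead through
        \<open>S\<^sub>- \<delta>y\<close>: its value at \<open>s\<close> depends on the input up to
        \<open>Suc s\<close>. Agreement of \<open>d\<close> and \<open>e\<close> up to
        \<open>t\<close> thus gives agreement of \<open>V\<close> strictly before
        \<open>t\<close>.\<close>
      have V: "V d s = V e s" if "s < t" for s
        unfolding V_def
      proof (rule causalD[OF causal_M])
        fix r assume "r \<le> s"
        then have r: "Suc r \<le> t" using that by simp
        have "A (S\<^sub>+ (S\<^sub>- (fst \<circ> snd \<circ> d))) r = A (S\<^sub>+ (S\<^sub>- (fst \<circ> snd \<circ> e))) r"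
          using r de by (intro causalD[OF A(2)]) (simp add: shift_right_def split: nat.split)
        moreover have "B (snd \<circ> snd \<circ> d) r = B (snd \<circ> snd \<circ> e) r"
          using r de by (intro causalD[OF B(2)]) simp
        ultimately show "effective_input A B (fst \<circ> d) (fst \<circ> snd \<circ> d) (snd \<circ> snd \<circ> d) r =
            effective_input A B (fst \<circ> e) (fst \<circ> snd \<circ> e) (snd \<circ> snd \<circ> e) r"
          using r de by (simp add: effective_input_def)
      qed
      \<comment> \<open>Strict causality of \<open>Phi_x\<close> and \<open>Phi_u\<close> absorbs
        the one-step lookahead, as does \<open>S\<^sub>+\<close> in the \<open>w_hat\<close>
        component.\<close>
      then have "Phi_x (V d) t = Phi_x (V e) t" "Phi_u (V d) t = Phi_u (V e) t"
        by (auto intro!: strictly_causalD[OF assms(4)] strictly_causalD[OF assms(7)])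
      then show "response_map A B Phi_x Phi_u d t = response_map A B Phi_x Phi_u e t"
        using V de by (simp add: response shift_right_def split: nat.split)
    qed
    ultimately show ?thesis by (simp add: L_TV_iff)
  qed
  ultimately show ?thesis
    using wp bij closed_loop by (auto simp: interconnection_stable_def)
qed

end
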